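(* For every positive integer $d$ there is an oriented regular hypermap whose duality index is equal to $d$ and is not extreme.
   Context: An oriented regular hypermap is a triple $\mathcal{H}=(G,x,y)$ where $G$ is a group generated by the ordered pair $x,y$ (equivalently, $G=\Delta^+/H$ for a normal subgroup $H$ of the free group $\Delta^+$ of rank $2$, with $x,y$ the images of the two free generators). The group $G$ is the monodromy group $Mon(\mathcal{H})$. Such a hypermap is self-dual if there is an automorphism of $G$ interchanging $x$ and $y$. The duality group $D(\mathcal{H})$ is the smallest normal subgroup $N\trianglelefteq G$ such that the assignment $x\mapsto y$, $y\mapsto x$ induces an automorphism of $G/N$ (equivalently, such that $\mathcal{H}/N=(G/N,xN,yN)$ is self-dual). The duality index of $\mathcal{H}$ is $|D(\mathcal{H})|$. The hypermap has extreme duality index if $D(\mathcal{H})=G$; otherwise its duality index is called non extreme. *)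

theory Defs
  imports "HOL-Algebra.Algebra"
begin

text \<open>
  The monodromy group \<open>G\<close> may be infinite. Being generated by two elements it is countable,
  so every oriented regular hypermap is isomorphic to one whose carrier consists of natural
  numbers.
\<close>

locale oriented_regular_hypermap = group G for G (structure) +
  fixes x y
  assumes x_carrier: "x \<in> carrier G" and y_carrier: "y \<in> carrier G"
    and generators: "generate G {x, y} = carrier G"

definition self_dual :: "('a, 'b) monoid_scheme \<Rightarrow> 'a \<Rightarrow> 'a \<Rightarrow> bool" where
  "self_dual G x y \<longleftrightarrow> (\<exists>\<phi> \<in> iso G G. \<phi> x = y \<and> \<phi> y = x)"

definition self_dual_quotient ::
    "('a, 'b) monoid_scheme \<Rightarrow> 'a \<Rightarrow> 'a \<Rightarrow> 'a set \<Rightarrow> bool" where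
  "self_dual_quotient G x y N \<longleftrightarrow>
     N \<lhd> G \<and> self_dual (G Mod N) (N #>\<^bsub>G\<^esub> x) (N #>\<^bsub>G\<^esub> y)"

text \<open>
  \<open>LEAST\<close> refers to inclusion of sets. For an oriented regular hypermap the least element
  exists, see \<open>duality_group_least\<close> below.
\<close>

definition duality_group :: "('a, 'b) monoid_scheme \<Rightarrow> 'a \<Rightarrow> 'a \<Rightarrow> 'a set" where
  "duality_group G x y = (LEAST N. self_dual_quotient G x y N)"

text \<open>The value is \<open>0\<close> if the duality group is infinite.\<close>

definition duality_index :: "('a, 'b) monoid_scheme \<Rightarrow> 'a \<Rightarrow> 'a \<Rightarrow> nat" where
  "duality_index G x y = card (duality_group G x y)"

definition extreme_duality_index :: "('a, 'b) monoid_scheme \<Rightarrow> 'a \<Rightarrow> 'a \<Rightarrow> bool" where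
  "extreme_duality_index G x y \<longleftrightarrow> duality_group G x y = carrier G"

context oriented_regular_hypermap
begin

text \<open>
  The subgroup of \<open>G \<times> G\<close> generated by \<open>(x, y)\<close> and \<open>(y, x)\<close>: the pairs \<open>(w(x, y), w(y, x))\<close>
  for words \<open>w\<close> in two letters.
\<close>

definition swap_rel :: "('a \<times> 'a) set" where
  "swap_rel = generate (G \<times>\<times> G) {(x, y), (y, x)}"

lemma swap_rel_subgroup: "subgroup swap_rel (G \<times>\<times> G)"
  unfolding swap_rel_def
  by (rule group.generate_is_subgroup[OF DirProd_group[OF is_group is_group]])
     (auto simp: x_carrier y_carrier)

lemma swap_rel_carrier: "(a, b) \<in> swap_rel \<Longrightarrow> a \<in> carrier G \<and> b \<in> carrier G"
  using subgroup.subset[OF swap_rel_subgroup] by auto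

lemma swap_rel_mult:
  assumes "(a, b) \<in> swap_rel" "(c, d) \<in> swap_rel"
  shows "(a \<otimes> c, b \<otimes> d) \<in> swap_rel"
  using subgroup.m_closed[OF swap_rel_subgroup assms] by simp

lemma swap_rel_inv:
  assumes "(a, b) \<in> swap_rel" shows "(inv a, inv b) \<in> swap_rel"
  using subgroup.m_inv_closed[OF swap_rel_subgroup assms] swap_rel_carrier[OF assms]
  by (simp add: inv_DirProd[OF is_group is_group])

lemma swap_rel_one: "(\<one>, \<one>) \<in> swap_rel"
  using subgroup.one_closed[OF swap_rel_subgroup] by simp

lemma swap_rel_gens: "(x, y) \<in> swap_rel" "(y, x) \<in> swap_rel"
  unfolding swap_rel_def by (auto intro: generate.incl)

lemma swap_rel_induct [consumes 1, case_names one xy yx inv mult]: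
  assumes "(a, b) \<in> swap_rel"
    and "P \<one> \<one>" "P x y" "P y x"
    and inv: "\<And>a b. a \<in> carrier G \<Longrightarrow> b \<in> carrier G \<Longrightarrow> P a b \<Longrightarrow> P (inv a) (inv b)"
    and mult: "\<And>a b c d. \<lbrakk>(a, b) \<in> swap_rel; (c, d) \<in> swap_rel; P a b; P c d\<rbrakk>
      \<Longrightarrow> P (a \<otimes> c) (b \<otimes> d)"
  shows "P a b"
proof -
  have "p \<in> swap_rel \<Longrightarrow> P (fst p) (snd p)" for p
    unfolding swap_rel_def
  proof (induction p rule: generate.induct)
    case one
    then show ?case using assms by simp
  next
    case (incl h)
    then show ?case using assms by auto
  next
    case (inv h)
    then show ?case
      using assms(3,4) assms(5)[OF x_carrier y_carrier] assms(5)[OF y_carrier x_carrier]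
      by (auto simp: inv_DirProd[OF is_group is_group] x_carrier y_carrier)
  next
    case (eng h1 h2)
    then show ?case
      using mult[of "fst h1" "snd h1" "fst h2" "snd h2"]
      by (simp add: swap_rel_def mult_DirProd')
  qed
  from this[OF assms(1)] show ?thesis by simp
qed

lemma swap_rel_sym: "(a, b) \<in> swap_rel \<Longrightarrow> (b, a) \<in> swap_rel"
  by (induction rule: swap_rel_induct)
     (auto simp: swap_rel_one swap_rel_gens intro: swap_rel_inv swap_rel_mult
       swap_rel_carrier)

lemma swap_rel_total:
  assumes "a \<in> carrier G" obtains b where "(a, b) \<in> swap_rel"
proof -
  have "a \<in> generate G {x, y} \<Longrightarrow> \<exists>b. (a, b) \<in> swap_rel"
    by (induction rule: generate.induct)
       (use swap_rel_one swap_rel_gens swap_rel_inv swap_rel_mult in blast)+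
  then show ?thesis using assms generators that by auto
qed

lemma swap_rel_self_dual_quotient:
  assumes "self_dual_quotient G x y N" "(a, b) \<in> swap_rel" "a \<in> N"
  shows "b \<in> N"
proof -
  interpret N: normal N G using assms(1) by (simp add: self_dual_quotient_def)
  interpret Q: group "G Mod N" by (rule N.factorgroup_is_group)
  obtain \<phi> where \<phi>: "\<phi> \<in> iso (G Mod N) (G Mod N)"
      "\<phi> (N #> x) = N #> y" "\<phi> (N #> y) = N #> x"
    using assms(1) unfolding self_dual_quotient_def self_dual_def by blast
  interpret \<phi>: group_hom "G Mod N" "G Mod N" \<phi>
    using \<phi>(1) by unfold_locales (simp add: iso_def)
  have one: "\<phi> N = N" using \<phi>.hom_one by simp
  have car: "N #> c \<in> carrier (G Mod N)" if "c \<in> carrier G" for c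
    using that by (simp add: carrier_FactGroup)
  have inv_c: "inv\<^bsub>G Mod N\<^esub> (N #> c) = N #> inv c" if "c \<in> carrier G" for c
    using that car[OF that] by (simp add: N.inv_FactGroup N.rcos_inv)
  have "\<phi> (N #> a) = N #> b" using assms(2)
  proof (induction rule: swap_rel_induct)
    case one
    then show ?case using \<open>\<phi> N = N\<close> by (simp add: N.subset)
  next
    case (inv a b)
    then show ?case using \<phi>.hom_inv[OF car[OF inv(1)]] by (simp add: inv_c)
  next
    case (mult a b c d)
    note abcd = swap_rel_carrier[OF mult(1)] swap_rel_carrier[OF mult(2)]
    then show ?case
      using mult(3,4) \<phi>.hom_mult[OF car car, of a c] by (simp add: N.rcos_sum)
  qed (use \<phi> in auto)
  moreover have "N #> a = N"
    using assms(3) by (simp add: N.subgroup_axioms N.mem_carrier coset_join2)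
  ultimately have "N #> b = N" using one by simp
  then show ?thesis
    using swap_rel_carrier[OF assms(2)] N.subgroup_axioms coset_join1 N.subset by blast
qed

lemma self_dual_quotientI:
  assumes "N \<lhd> G" and swap: "\<And>a b. (a, b) \<in> swap_rel \<Longrightarrow> a \<in> N \<Longrightarrow> b \<in> N"
  shows "self_dual_quotient G x y N"
proof -
  interpret N: normal N G by fact
  have eq: "N #> b = N #> d" if "(a, b) \<in> swap_rel" "(c, d) \<in> swap_rel" "N #> a = N #> c"
    for a b c d
  proof -
    note car = swap_rel_carrier[OF that(1)] swap_rel_carrier[OF that(2)]
    have "a \<in> N #> c" using that(3) car rcos_self[OF _ N.subgroup_axioms, of a] by simp
    then have "a \<otimes> inv c \<in> N" using N.rcos_module_imp[OF is_group, of c a] car by simp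
    then have "b \<otimes> inv d \<in> N" using swap swap_rel_mult[OF that(1) swap_rel_inv[OF that(2)]] by blast
    then have "b \<in> N #> d" using N.rcos_module_rev[OF is_group, of d b] car by simp
    then show ?thesis using car repr_independence N.subgroup_axioms by blast
  qed
  define \<psi> where "\<psi> C = N #> (SOME b. \<exists>a. N #> a = C \<and> (a, b) \<in> swap_rel)" for C
  have \<psi>: "\<psi> (N #> a) = N #> b" if "(a, b) \<in> swap_rel" for a b
  proof -
    have "\<exists>a'. N #> a' = N #> a \<and> (a', SOME b. \<exists>a'. N #> a' = N #> a \<and> (a', b) \<in> swap_rel) \<in> swap_rel"
      by (rule someI_ex) (use that in blast)
    then show ?thesis unfolding \<psi>_def using eq[OF _ that] by blast
  qed
  have rep: "\<exists>a b. C = N #> a \<and> (a, b) \<in> swap_rel" if "C \<in> carrier (G Mod N)" for C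
  proof -
    obtain a where "a \<in> carrier G" "C = N #> a"
      using \<open>C \<in> _\<close> by (auto simp: carrier_FactGroup)
    moreover obtain b where "(a, b) \<in> swap_rel"
      using swap_rel_total[OF \<open>a \<in> carrier G\<close>] .
    ultimately show ?thesis by blast
  qed
  have closed: "\<psi> C \<in> carrier (G Mod N)" if "C \<in> carrier (G Mod N)" for C
  proof -
    obtain a b where *: "C = N #> a" "(a, b) \<in> swap_rel" using rep[OF \<open>C \<in> _\<close>] by blast
    then show ?thesis using \<psi>[OF *(2)] swap_rel_carrier[OF *(2)] by (simp add: carrier_FactGroup)
  qed
  have invol: "\<psi> (\<psi> C) = C" if "C \<in> carrier (G Mod N)" for C
  proof -
    obtain a b where *: "C = N #> a" "(a, b) \<in> swap_rel" using rep[OF \<open>C \<in> _\<close>] by blast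
    then show ?thesis using \<psi>[OF *(2)] \<psi>[OF swap_rel_sym[OF *(2)]] by simp
  qed
  have hom: "\<psi> (C <#> D) = \<psi> C <#> \<psi> D" if CD: "C \<in> carrier (G Mod N)" "D \<in> carrier (G Mod N)" for C D
  proof -
    obtain a b c d where *: "C = N #> a" "(a, b) \<in> swap_rel" "D = N #> c" "(c, d) \<in> swap_rel"
      using rep[OF CD(1)] rep[OF CD(2)] by blast
    then show ?thesis
      using \<psi>[OF swap_rel_mult[OF *(2,4)]] \<psi>[OF *(2)] \<psi>[OF *(4)]
        swap_rel_carrier[OF *(2)] swap_rel_carrier[OF *(4)] by (simp add: N.rcos_sum)
  qed
  have "\<psi> \<in> iso (G Mod N) (G Mod N)"
  proof (rule isoI)
    show "\<psi> \<in> hom (G Mod N) (G Mod N)"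
      by (rule homI) (simp_all add: closed hom)
    show "bij_betw \<psi> (carrier (G Mod N)) (carrier (G Mod N))"
      by (rule bij_betw_byWitness[where f' = \<psi>]) (use closed invol in blast)+
  qed
  then show ?thesis
    unfolding self_dual_quotient_def self_dual_def
    using \<open>N \<lhd> G\<close> \<psi>[OF swap_rel_gens(1)] \<psi>[OF swap_rel_gens(2)] by blast
qed

lemma duality_group_least:
  shows "self_dual_quotient G x y (duality_group G x y)"
    and "self_dual_quotient G x y N \<Longrightarrow> duality_group G x y \<subseteq> N"
proof -
  define D where "D = \<Inter>{N. self_dual_quotient G x y N}"
  have "carrier G \<lhd> G"
    by (rule normal_invI) (auto simp: subgroup_self)
  then have carr: "self_dual_quotient G x y (carrier G)"
    by (rule self_dual_quotientI) (simp add: swap_rel_carrier)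
  have "subgroup D G"
    unfolding D_def using carr
    by (intro subgroups_Inter) (auto simp: self_dual_quotient_def normal_imp_subgroup)
  then have "D \<lhd> G"
    by (rule normal_invI)
       (auto simp: D_def self_dual_quotient_def normal.inv_op_closed2)
  then have D: "self_dual_quotient G x y D"
    by (rule self_dual_quotientI) (auto simp: D_def intro: swap_rel_self_dual_quotient)
  have min: "D \<subseteq> N" if "self_dual_quotient G x y N" for N
    using that unfolding D_def by blast
  have "duality_group G x y = D"
    unfolding duality_group_def using D min by (rule Least_equality)
  then show "self_dual_quotient G x y (duality_group G x y)"
    and "self_dual_quotient G x y N \<Longrightarrow> duality_group G x y \<subseteq> N"
    using D min by auto
qed

end

end

theory Submission
  imports Defs
begin

text \<open>
  The witness is the cyclic group of order \<open>3 d\<close> with the generating pair \<open>x = 1\<close>, \<open>y = 2\<close>.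
  Its generators satisfy \<open>y = 2 x\<close>, so in a quotient in which they may be interchanged also
  \<open>x = 2 y = 4 x\<close>, that is \<open>3 x = 0\<close>; hence every self-dual quotient kills the multiples of \<open>3\<close>
  (lemma \<open>multiples_of_3_subset\<close>). Modulo \<open>3\<close>, on the other hand, \<open>2\<close> is \<open>-1\<close> and negation is
  an automorphism interchanging the generators, so that killing the multiples of \<open>3\<close> is enough
  (lemma \<open>multiples_of_3_self_dual_quotient\<close>). The duality group therefore consists of the
  multiples of \<open>3\<close>: it has order \<open>d\<close> and index \<open>3\<close>, so it is proper.
\<close>

definition cyclic_nat_group :: "nat \<Rightarrow> nat monoid" where
  "cyclic_nat_group n = \<lparr>carrier = {..<n}, monoid.mult = (\<lambda>a b. (a + b) mod n), one = 0\<rparr>"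

lemma cyclic_nat_group_simps [simp]:
  "carrier (cyclic_nat_group n) = {..<n}"
  "a \<otimes>\<^bsub>cyclic_nat_group n\<^esub> b = (a + b) mod n"
  "\<one>\<^bsub>cyclic_nat_group n\<^esub> = 0"
  by (simp_all add: cyclic_nat_group_def)

lemma cyclic_nat_group_comm_group:
  assumes "n > 0" shows "comm_group (cyclic_nat_group n)"
proof (rule comm_groupI)
  fix a assume "a \<in> carrier (cyclic_nat_group n)"
  then show "\<exists>b \<in> carrier (cyclic_nat_group n). b \<otimes>\<^bsub>cyclic_nat_group n\<^esub> a = \<one>\<^bsub>cyclic_nat_group n\<^esub>"
    using assms by (intro bexI[of _ "(n - a) mod n"]) (auto simp: mod_add_left_eq)
qed (use assms in \<open>auto simp: mod_add_left_eq mod_add_right_eq ac_simps\<close>)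

lemma cyclic_nat_group_inv:
  assumes "a < n" shows "inv\<^bsub>cyclic_nat_group n\<^esub> a = (n - a) mod n"
proof -
  interpret comm_group "cyclic_nat_group n"
    using assms by (intro cyclic_nat_group_comm_group) simp
  show ?thesis
    by (rule inv_equality) (use assms in \<open>auto simp: mod_add_left_eq\<close>)
qed

lemma cyclic_nat_group_hypermap:
  assumes "n > 2" shows "oriented_regular_hypermap (cyclic_nat_group n) 1 2"
proof -
  interpret comm_group "cyclic_nat_group n"
    using assms by (intro cyclic_nat_group_comm_group) simp
  have "a < n \<Longrightarrow> a \<in> generate (cyclic_nat_group n) {1, 2}" for a
  proof (induction a)
    case 0
    then show ?case using generate.one[of "cyclic_nat_group n"] by simp
  next
    case (Suc a)
    then show ?case
      using generate.eng[of a "cyclic_nat_group n" "{1, 2}" 1] generate.incl[of 1 "{1, 2}" "cyclic_nat_group n"]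
      by simp
  qed
  then have "generate (cyclic_nat_group n) {1, 2} = carrier (cyclic_nat_group n)"
    using generate_in_carrier[of "{1, 2}"] assms by auto
  then show ?thesis
    using assms by unfold_locales auto
qed

text \<open>
  Interchanging the generators turns the expression \<open>2 x - y\<close>, whose value is \<open>0\<close>, into
  \<open>2 y - x\<close>, whose value is \<open>3\<close>. So \<open>3\<close> lies in \<open>N\<close>, and with it all its multiples.
\<close>

lemma multiples_of_3_subset:
  assumes "n > 2" and N: "self_dual_quotient (cyclic_nat_group n) 1 2 N"
  shows "{a. a < n \<and> 3 dvd a} \<subseteq> N"
proof -
  interpret oriented_regular_hypermap "cyclic_nat_group n" 1 2
    by (rule cyclic_nat_group_hypermap) fact
  interpret N: normal N "cyclic_nat_group n"
    using N by (simp add: self_dual_quotient_def)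
  \<comment> \<open>The pair \<open>(2 x, 2 y)\<close> and, below it, the pair \<open>(- y, - x)\<close>.\<close>
  have "(2, 4 mod n) \<in> swap_rel"
    using swap_rel_mult[OF swap_rel_gens(1) swap_rel_gens(1)] \<open>n > 2\<close>
    by (simp del: One_nat_def add: one_add_one)
  moreover have "(n - 2, n - 1) \<in> swap_rel"
    using swap_rel_inv[OF swap_rel_gens(2)] \<open>n > 2\<close> by (simp add: cyclic_nat_group_inv)
  ultimately have "((2 + (n - 2)) mod n, (4 mod n + (n - 1)) mod n) \<in> swap_rel"
    using swap_rel_mult by fastforce
  moreover have "(4 mod n + (n - 1)) mod n = 3 mod n"
  proof -
    have "(4 mod n + (n - 1)) mod n = (4 + (n - 1)) mod n"
      by (rule mod_add_left_eq)
    also have "4 + (n - 1) = 3 + n"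
      using \<open>n > 2\<close> by simp
    finally show ?thesis by simp
  qed
  moreover have "(2 + (n - 2)) mod n = 0"
    using \<open>n > 2\<close> by (simp del: add_2_eq_Suc)
  ultimately have "(0, 3 mod n) \<in> swap_rel"
    by argo
  then have three: "3 mod n \<in> N"
    using swap_rel_self_dual_quotient[OF N] N.one_closed by simp
  have "3 * k mod n \<in> N" for k
  proof (induction k)
    case 0
    then show ?case using N.one_closed by simp
  next
    case (Suc k)
    then show ?case using N.m_closed[OF three Suc] by (simp add: mod_add_eq)
  qed
  then show ?thesis
    by (metis (mono_tags, lifting) dvdE mem_Collect_eq mod_less subsetI)
qed

text \<open>
  Reduction modulo \<open>3\<close> is well defined on residues modulo \<open>n\<close> because \<open>3\<close> divides \<open>n\<close>. There the
  generators are negatives of each other, hence so are any two elements expressed by a word and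
  by the word with the generators interchanged.
\<close>

lemma multiples_of_3_self_dual_quotient:
  assumes "n > 2" and "3 dvd n"
  shows "self_dual_quotient (cyclic_nat_group n) 1 2 {a. a < n \<and> 3 dvd a}"
proof -
  interpret oriented_regular_hypermap "cyclic_nat_group n" 1 2
    by (rule cyclic_nat_group_hypermap) fact
  interpret comm_group "cyclic_nat_group n"
    using assms by (intro cyclic_nat_group_comm_group) simp
  have mod_3: "3 dvd a mod n + b mod n \<longleftrightarrow> 3 dvd a + b" for a b
  proof -
    have "(a mod n + b mod n) mod 3 = (a mod n mod 3 + b mod n mod 3) mod 3"
      by (rule mod_add_eq[symmetric])
    also have "\<dots> = (a + b) mod 3"
      using \<open>3 dvd n\<close> by (simp add: mod_mod_cancel mod_add_eq)
    finally show ?thesis by (simp add: dvd_eq_mod_eq_0)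
  qed
  have neg: "3 dvd a + b" if "(a, b) \<in> swap_rel" for a b
    using that
  proof (induction rule: swap_rel_induct)
    case (inv a b)
    then have "3 dvd (n - a) + (n - b)"
      using \<open>3 dvd n\<close> by simp
    then show ?case using inv by (simp add: cyclic_nat_group_inv mod_3)
  next
    case (mult a b c d)
    then have "3 dvd (a + c) + (b + d)"
      by presburger
    then show ?case by (simp add: mod_3)
  qed (simp_all del: One_nat_def)
  have "subgroup {a. a < n \<and> 3 dvd a} (cyclic_nat_group n)"
    by (rule subgroupI)
       (use assms in \<open>auto simp: cyclic_nat_group_inv dvd_mod intro!: exI[of _ 0]\<close>)
  then have "{a. a < n \<and> 3 dvd a} \<lhd> cyclic_nat_group n"
    by (simp add: normal_iff_subgroup)
  then show ?thesis
  proof (rule self_dual_quotientI)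
    fix a b assume "(a, b) \<in> swap_rel" "a \<in> {a. a < n \<and> 3 dvd a}"
    then show "b \<in> {a. a < n \<and> 3 dvd a}"
      using neg[of a b] swap_rel_carrier[of a b] by (simp add: dvd_add_right_iff)
  qed
qed

lemma duality_group_cyclic_nat_group:
  assumes "n > 2" and "3 dvd n"
  shows "duality_group (cyclic_nat_group n) 1 2 = {a. a < n \<and> 3 dvd a}"
proof -
  interpret oriented_regular_hypermap "cyclic_nat_group n" 1 2
    by (rule cyclic_nat_group_hypermap) fact
  show ?thesis
    using duality_group_least multiples_of_3_subset multiples_of_3_self_dual_quotient assms
    by (simp add: subset_antisym)
qed

theorem theorem5p2:
  fixes d :: nat
  assumes "d > 0"
  shows "\<exists>(G :: nat monoid) x y. oriented_regular_hypermap G x y \<and>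
           duality_index G x y = d \<and> \<not> extreme_duality_index G x y"
proof -
  have n: "3 * d > 2" using assms by simp
  have D: "duality_group (cyclic_nat_group (3 * d)) 1 2 = {a. a < 3 * d \<and> 3 dvd a}"
    using duality_group_cyclic_nat_group[OF n] by simp
  have "{a. a < 3 * d \<and> 3 dvd a} = (*) 3 ` {..<d}"
    by auto
  then have "card {a. a < 3 * d \<and> 3 dvd a} = d"
    by (simp add: card_image inj_on_def)
  then have "duality_index (cyclic_nat_group (3 * d)) 1 2 = d"
    by (simp only: duality_index_def D)
  moreover have "1 \<in> {..<3 * d} \<and> 1 \<notin> {a. a < 3 * d \<and> (3 :: nat) dvd a}"
    using n by simp
  then have "\<not> extreme_duality_index (cyclic_nat_group (3 * d)) 1 2"
    unfolding extreme_duality_index_def D cyclic_nat_group_simps by blast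
  ultimately show ?thesis
    using cyclic_nat_group_hypermap[OF n] by blast
qed

end
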